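(* Let $n\ge 2$, let $\boldsymbol{\tau}_n=23\cdots n1$ and $\triangle_n=\operatorname{conv}(\mathcal{S}^{\boldsymbol{\tau}_n})\subset\mathbb{R}^n$. Then for all integers $t\ge 0$, \[L_{\mathbb{Z}}(\triangle_n^{\circ};t+2)=(t+1)^{n-1}=L_{\mathbb{Z}}(\triangle_n;t),\] and moreover $L_{\mathbb{Z}}(\triangle_n^{\circ};1)=0$ and $L_{\mathbb{Z}}(\triangle_n^{\circ};2)=1$. Therefore $\triangle_n$ is Gorenstein of index $2$.
   Context: Stack-sorting: for a finite sequence $\boldsymbol{\pi}=\pi_1\pi_2\cdots\pi_n$ of distinct elements of a totally ordered set, the output $s(\boldsymbol{\pi})$ is obtained as follows. Start with an empty stack (last-in, first-out) and an empty output. For $i=1,\dots,n$ in order: while the stack is nonempty and $\pi_i$ is greater than the top element of the stack, pop the top element and append it to the end of the output; then push $\pi_i$ onto the stack. After all entries have been pushed, pop all remaining elements from top to bottom, appending each to the output. Write $s^0(\boldsymbol{\pi})=\boldsymbol{\pi}$ and $s^{i}(\boldsymbol{\pi})=s(s^{i-1}(\boldsymbol{\pi}))$. For a permutation $\boldsymbol{\pi}$ of $\{1,\dots,n\}$, iterating $s$ eventually reaches the identity $12\cdots n$ (fixed by $s$), and $\mathcal{S}^{\boldsymbol{\pi}}:=\{s^0(\boldsymbol{\pi}),s^1(\boldsymbol{\pi}),\dots\}$ is the finite set of all iterates until the identity is reached. Permutations $\pi_1\cdots\pi_n$ in one-line notation are identified with points $(\pi_1,\dots,\pi_n)\in\mathbb{R}^n$.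 $P^{\circ}$ denotes the relative interior of a polytope $P$ (its interior within its affine hull). For a lattice polytope $P\subset\mathbb{R}^n$ and an integer $t\ge 0$, $L_{\mathbb{Z}}(P;t):=|tP\cap\mathbb{Z}^n|$, and for an integer $t\ge 1$, $L_{\mathbb{Z}}(P^{\circ};t):=|tP^{\circ}\cap\mathbb{Z}^n|$. A lattice polytope $P$ is Gorenstein of index $k$ (with $k$ a positive integer) if $L_{\mathbb{Z}}(P^{\circ};k-1)=0$, $L_{\mathbb{Z}}(P^{\circ};k)=1$, and $L_{\mathbb{Z}}(P^{\circ};t)=L_{\mathbb{Z}}(P;t-k)$ for all integers $t>k$. *)

theory Defs
  imports "HOL-Analysis.Analysis"
begin

text \<open>The arguments are the remaining input, the stack (its top is the head of the list) and the
  output produced so far.\<close>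

fun stack_run :: "'a::linorder list \<Rightarrow> 'a list \<Rightarrow> 'a list \<Rightarrow> 'a list" where
  "stack_run [] st out = out @ st"
| "stack_run (x # xs) [] out = stack_run xs [x] out"
| "stack_run (x # xs) (y # st) out =
    (if x > y then stack_run (x # xs) st (out @ [y]) else stack_run xs (x # y # st) out)"

definition stack_sort :: "'a::linorder list \<Rightarrow> 'a list" where
  "stack_sort xs = stack_run xs [] []"

text \<open>The identity is a fixed point of stack-sorting, so the set of iterates up to the identity is
  the set of all iterates.\<close>

definition stack_iterates :: "'a::linorder list \<Rightarrow> 'a list set" where
  "stack_iterates xs = {(stack_sort ^^ i) xs | i. True}"

definition tau :: "nat \<Rightarrow> nat list" where
  "tau n = [2..<n + 1] @ [1]"

text \<open>Coordinates of \<open>\<real>\<^sup>n\<close> are indexed by an arbitrary finite linearly ordered type with \<open>n\<close>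
  elements. The \<open>k\<close>-th smallest index, which has \<open>k - 1\<close> predecessors, carries the \<open>k\<close>-th entry of
  the one-line notation.\<close>

definition perm_point :: "nat list \<Rightarrow> real ^ 'n::{finite,linorder}" where
  "perm_point xs = (\<chi> i. real (xs ! card {j. j < i}))"

definition stack_simplex :: "nat \<Rightarrow> (real ^ 'n::{finite,linorder}) set" where
  "stack_simplex n = convex hull (perm_point ` stack_iterates (tau n))"

definition int_lattice :: "(real ^ 'n) set" where
  "int_lattice = {x. \<forall>i. x $ i \<in> \<int>}"

definition lattice_polytope :: "(real ^ 'n) set \<Rightarrow> bool" where
  "lattice_polytope P \<longleftrightarrow> (\<exists>V. finite V \<and> V \<subseteq> int_lattice \<and> P = convex hull V)"

definition lattice_count :: "(real ^ 'n) set \<Rightarrow> nat \<Rightarrow> nat" where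
  "lattice_count S t = card (((\<lambda>x. real t *\<^sub>R x) ` S) \<inter> int_lattice)"

text \<open>The lattice point count of the relative interior is only meaningful for positive dilation
  factors, so for \<open>k = 1\<close> there is no condition at \<open>k - 1\<close>.\<close>

definition gorenstein :: "(real ^ 'n) set \<Rightarrow> nat \<Rightarrow> bool" where
  "gorenstein P k \<longleftrightarrow>
     lattice_polytope P \<and> k \<ge> 1 \<and>
     (k > 1 \<longrightarrow> lattice_count (rel_interior P) (k - 1) = 0) \<and>
     lattice_count (rel_interior P) k = 1 \<and>
     (\<forall>t>k. lattice_count (rel_interior P) t = lattice_count P (t - k))"

end

theory Submission
  imports Defs
begin

text \<open>
  Each pass of stack-sorting moves the entry \<open>1\<close> of \<open>23\<dots>n1\<close> one place to the left and keeps the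
  others in increasing order, so the orbit consists of \<open>n\<close> points \<open>p\<^sub>0, \<dots>, p\<^sub>n\<^sub>-\<^sub>1\<close>, where \<open>p\<^sub>k\<close> has its
  \<open>1\<close> at position \<open>k\<close> (counted from \<open>0\<close>). They are affinely independent, hence the points of \<open>t\<triangle>\<close>
  are the combinations \<open>x = \<Sum> \<mu>\<^sub>k p\<^sub>k\<close> with \<open>\<mu>\<^sub>k \<ge> 0\<close> and \<open>\<Sum> \<mu>\<^sub>k = t\<close>, and the relative interior asks for
  \<open>\<mu>\<^sub>k > 0\<close> instead.

  Put \<open>b\<^sub>k = k (\<mu>\<^sub>0 + \<dots> + \<mu>\<^sub>k\<^sub>-\<^sub>1)\<close>. By lemma \<open>combination_nth\<close> the coordinates of \<open>x\<close> are
  \<open>x\<^sub>j = t (j + 2) + b\<^sub>j - b\<^sub>j\<^sub>+\<^sub>1\<close>. Since \<open>b\<^sub>0 = 0\<close>, the point \<open>x\<close> is integral if and only if all \<open>b\<^sub>k\<close> are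
  integers, and the sign conditions on \<open>\<mu>\<close> become
  \<open>0 \<le> b\<^sub>1/1 \<le> b\<^sub>2/2 \<le> \<dots> \<le> b\<^sub>n\<^sub>-\<^sub>1/(n - 1) \<le> t\<close>, with strict inequalities for the relative interior.
  Lattice points therefore correspond to lecture hall sequences (\<open>bij_betw_lecture_hall_point\<close>).

  These are counted by allowing any integer bound \<open>b\<^sub>m \<le> m t + r\<close> on the last term, \<open>0 \<le> r \<le> m\<close>: there
  are \<open>(t + 1)\<^sup>m\<^sup>-\<^sup>r (t + 2)\<^sup>r\<close> of them (\<open>card_lecture_hall\<close>), by induction on \<open>m\<close> and the value of
  the last term. The case \<open>r = 0\<close> is the count for \<open>t\<triangle>\<close>. Finally, adding \<open>2k - 1\<close> to \<open>b\<^sub>k\<close> turns weak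
  sequences with bound \<open>j\<close> bijectively into strict ones with bound \<open>j + 2m\<close>
  (\<open>bij_betw_lecture_hall_strict\<close>), so that the interior of \<open>(t + 2)\<triangle>\<close> has as many lattice points as
  \<open>t\<triangle>\<close>. This is the Gorenstein property of index \<open>2\<close>.
\<close>

section \<open>The stack-sorting orbit\<close>

definition one_at :: "nat \<Rightarrow> nat \<Rightarrow> nat list" where
  "one_at n m = [2..<m + 2] @ 1 # [m + 2..<n + 1]"

text \<open>On increasing input every new entry pops its predecessor, so the stack never holds more than
  one element. This describes a pass before and after it meets the entry \<open>1\<close>.\<close>

lemma stack_run_increasing:
  assumes "sorted_wrt (<) (y # xs)"
  shows "stack_run (xs @ ys) [y] out = stack_run ys [last (y # xs)] (out @ butlast (y # xs))"
  using assms by (induction xs arbitrary: y out) auto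

text \<open>When \<open>1\<close> arrives, its left neighbour \<open>m + 1\<close> is alone on the stack. The entry \<open>1\<close> is put on top
  of it and leaves first, which exchanges the two. For \<open>m = 0\<close> the list is the identity, and the
  truncated difference \<open>m - 1\<close> expresses that it is fixed.\<close>

lemma stack_sort_one_at:
  assumes "m < n"
  shows "stack_sort (one_at n m) = one_at n (m - 1)"
proof (cases m)
  case 0
  have one: "one_at n 0 = 1 # [2..<n + 1]"
    by (simp add: one_at_def numeral_2_eq_2)
  have "stack_sort (1 # [2..<n + 1]) = butlast (1 # [2..<n + 1]) @ [last (1 # [2..<n + 1])]"
    unfolding stack_sort_def
    using stack_run_increasing[of "1" "[2..<n + 1]" "[]" "[]"]
    by (simp del: upt_Suc butlast.simps last.simps)
  also have "\<dots> = 1 # [2..<n + 1]"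
    by (rule append_butlast_last_id) simp
  finally show ?thesis
    using 0 one by simp
next
  case (Suc k)
  have "[2..<m + 2] = 2 # [3..<m + 2]"
    using Suc by (simp add: upt_conv_Cons del: upt_Suc)
  moreover have "butlast [2..<m + 2] = [2..<m + 1]" "last [2..<m + 2] = m + 1"
    using Suc by auto
  ultimately have 1: "stack_sort (one_at n m)
      = stack_run (1 # [m + 2..<n + 1]) [m + 1] [2..<m + 1]"
    unfolding stack_sort_def one_at_def
    using stack_run_increasing[of 2 "[3..<m + 2]" "1 # [m + 2..<n + 1]" "[]"]
    by (simp del: upt_Suc)
  have 2: "one_at n (m - 1) = [2..<m + 1] @ 1 # [m + 1..<n + 1]"
    using Suc unfolding one_at_def by simp
  show ?thesis
  proof (cases "m + 1 = n")
    case True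
    then show ?thesis unfolding 1 2 using Suc by auto
  next
    case False
    then have *: "[m + 2..<n + 1] = (m + 2) # [m + 3..<n + 1]"
      "[m + 1..<n + 1] = (m + 1) # (m + 2) # [m + 3..<n + 1]"
      using assms by (simp_all add: upt_conv_Cons numeral_3_eq_3 del: upt_Suc)
    have "sorted_wrt (<) ((m + 2) # [m + 3..<n + 1])"
      by (simp del: upt_Suc)
    from stack_run_increasing[OF this, of "[]" "[2..<m + 1] @ [1, m + 1]"]
    have "stack_run [m + 3..<n + 1] [m + 2] ([2..<m + 1] @ [1, m + 1])
        = [2..<m + 1] @ [1, m + 1] @ (m + 2) # [m + 3..<n + 1]"
      by (simp del: upt_Suc butlast.simps last.simps)
    then show ?thesis
      unfolding 1 2 * using Suc by (simp del: upt_Suc)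
  qed
qed

lemma stack_iterates_tau:
  assumes "n \<ge> 1"
  shows "stack_iterates (tau n) = one_at n ` {..<n}"
proof -
  have it: "(stack_sort ^^ i) (tau n) = one_at n (n - 1 - i)" for i
  proof (induction i)
    case 0
    show ?case using assms by (simp add: tau_def one_at_def)
  next
    case (Suc i)
    then show ?case using stack_sort_one_at[of "n - 1 - i" n] assms by simp
  qed
  have "m \<in> range (\<lambda>i. n - 1 - i)" if "m < n" for m
    using that by (intro image_eqI[of _ _ "n - 1 - m"]) auto
  then have "range (\<lambda>i. n - 1 - i) = {..<n}"
    using assms by auto
  moreover have "stack_iterates (tau n) = one_at n ` range (\<lambda>i. n - 1 - i)"
    unfolding stack_iterates_def it by auto
  ultimately show ?thesis by simp
qed

lemma nth_one_at:
  assumes "j < n" "m < n"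
  shows "one_at n m ! j = (if j < m then j + 2 else if j = m then 1 else j + 1)"
  using assms unfolding one_at_def
  by (auto simp: nth_append nth_Cons simp del: upt_Suc split: nat.split)

section \<open>Counting lecture hall sequences\<close>

text \<open>The chain \<open>0 \<le> b\<^sub>1/1 \<le> \<dots> \<le> b\<^sub>m/m \<le> j/m\<close> with denominators cleared. The sign condition \<open>P\<close> is
  a parameter, either \<open>0 \<le> u\<close> or \<open>0 < u\<close>, so that the closed polytope and its relative interior
  are treated by one argument. The entries \<open>b\<^sub>0\<close> and \<open>b\<^sub>k\<close> for \<open>k > m\<close> are fixed at \<open>0\<close> to make
  the representing function unique.\<close>

definition lecture_hall :: "(real \<Rightarrow> bool) \<Rightarrow> nat \<Rightarrow> int \<Rightarrow> (nat \<Rightarrow> int) set" where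
  "lecture_hall P m j = {b. b 0 = 0 \<and> P (of_int (b 1))
     \<and> (\<forall>k\<in>{1..<m}. P (of_int (int k * b (k + 1) - int (k + 1) * b k)))
     \<and> P (of_int (j - b m)) \<and> (\<forall>k>m. b k = 0)}"

abbreviation "weak \<equiv> (\<lambda>u::real. 0 \<le> u)"
abbreviation "strict \<equiv> (\<lambda>u::real. 0 < u)"

lemma lecture_hall_weak:
  "b \<in> lecture_hall weak m j \<longleftrightarrow> b 0 = 0 \<and> 0 \<le> b 1
     \<and> (\<forall>k\<in>{1..<m}. int (k + 1) * b k \<le> int k * b (k + 1)) \<and> b m \<le> j \<and> (\<forall>k>m. b k = 0)"
  unfolding lecture_hall_def mem_Collect_eq of_int_0_le_iff by auto

lemma lecture_hall_strict:
  "b \<in> lecture_hall strict m j \<longleftrightarrow> b 0 = 0 \<and> 0 < b 1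
     \<and> (\<forall>k\<in>{1..<m}. int (k + 1) * b k < int k * b (k + 1)) \<and> b m < j \<and> (\<forall>k>m. b k = 0)"
  unfolding lecture_hall_def mem_Collect_eq of_int_0_less_iff by auto

lemma lecture_hall_weak_nonneg:
  assumes "b \<in> lecture_hall weak m j" "k \<le> m"
  shows "0 \<le> b k"
  using assms(2)
proof (induction k)
  case 0
  show ?case using assms(1) by (simp add: lecture_hall_weak)
next
  case (Suc k)
  show ?case
  proof (cases "k = 0")
    case True
    then show ?thesis using assms(1) by (simp add: lecture_hall_weak)
  next
    case False
    have "0 \<le> int (k + 1) * b k" using Suc by simp
    also have "\<dots> \<le> int k * b (k + 1)"
      using assms(1) Suc.prems False by (auto simp: lecture_hall_weak)
    finally show ?thesis using False by (simp add: zero_le_mult_iff)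
  qed
qed

lemma le_zdiv_iff: "d > 0 \<Longrightarrow> a \<le> b div d \<longleftrightarrow> a * d \<le> b" for a b d :: int
proof
  assume d: "d > 0" and "a \<le> b div d"
  then have "a * d \<le> b div d * d" by simp
  also have "\<dots> \<le> b" using d by (simp add: pos_mod_sign minus_mod_eq_div_mult[symmetric])
  finally show "a * d \<le> b" .
next
  assume d: "d > 0" and "a * d \<le> b"
  then show "a \<le> b div d" using zdiv_mono1[of "a * d" b d] by simp
qed

text \<open>Given the last term \<open>i\<close>, the only condition that it puts on the remaining terms is
  \<open>b\<^sub>m \<le> \<lfloor>i m / (m + 1)\<rfloor>\<close>. The bound of the shorter sequence need not be a multiple of \<open>m\<close>,
  which is why arbitrary integer bounds are considered.\<close>

lemma lecture_hall_Suc: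
  "lecture_hall weak (Suc m) j
     = (\<Union>i\<in>{0..j}. (\<lambda>b. b(Suc m := i)) ` lecture_hall weak m (i * int m div int (Suc m)))"
    (is "?L = ?R")
proof (intro equalityI subsetI)
  fix b assume b: "b \<in> ?L"
  define c where "c = b(Suc m := 0)"
  let ?i = "b (Suc m)"
  have "b m \<le> ?i * int m div int (Suc m)"
  proof (cases "m = 0")
    case True
    then show ?thesis using b by (simp add: lecture_hall_weak)
  next
    case False
    then have "b m * int (Suc m) \<le> ?i * int m"
      using b by (auto simp: lecture_hall_weak mult.commute)
    then show ?thesis by (simp add: le_zdiv_iff del: of_nat_Suc)
  qed
  then have "c \<in> lecture_hall weak m (?i * int m div int (Suc m))"
    using b by (auto simp: lecture_hall_weak c_def)
  moreover have "b = c(Suc m := ?i)"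
    by (auto simp: c_def)
  moreover have "?i \<in> {0..j}"
    using b lecture_hall_weak_nonneg[OF b, of "Suc m"] by (simp add: lecture_hall_weak)
  ultimately show "b \<in> ?R" by blast
next
  fix b assume "b \<in> ?R"
  then obtain i c where i: "i \<in> {0..j}" and b: "b = c(Suc m := i)"
    and c: "c \<in> lecture_hall weak m (i * int m div int (Suc m))" by blast
  have "c m \<le> i * int m div int (Suc m)"
    using c by (simp add: lecture_hall_weak)
  then have "int (Suc m) * c m \<le> int m * i"
    by (simp add: le_zdiv_iff mult.commute del: of_nat_Suc)
  then show "b \<in> ?L"
    using i c unfolding b by (auto simp: lecture_hall_weak less_Suc_eq)
qed

lemma card_lecture_hall_Suc:
  assumes fin: "\<And>i. finite (lecture_hall weak m i)"
  shows "finite (lecture_hall weak (Suc m) j)"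
    and "card (lecture_hall weak (Suc m) j)
      = (\<Sum>i\<in>{0..j}. card (lecture_hall weak m (i * int m div int (Suc m))))"
proof -
  let ?F = "\<lambda>i. (\<lambda>b. b(Suc m := i)) ` lecture_hall weak m (i * int m div int (Suc m))"
  have inj: "inj_on (\<lambda>b. b(Suc m := i)) (lecture_hall weak m l)" for i l
  proof (rule inj_onI)
    fix b c assume "b \<in> lecture_hall weak m l" "c \<in> lecture_hall weak m l"
      and eq: "b(Suc m := i) = c(Suc m := i)"
    then have "b (Suc m) = c (Suc m)" by (simp add: lecture_hall_weak)
    then show "b = c" using eq by (metis fun_upd_triv fun_upd_upd)
  qed
  have disj: "?F i \<inter> ?F i' = {}" if "i \<noteq> i'" for i i'
    using that by (auto dest!: fun_cong[where x = "Suc m"])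
  show "finite (lecture_hall weak (Suc m) j)"
    unfolding lecture_hall_Suc using fin by simp
  have "card (lecture_hall weak (Suc m) j) = (\<Sum>i\<in>{0..j}. card (?F i))"
    unfolding lecture_hall_Suc using fin disj by (intro card_UN_disjoint) auto
  then show "card (lecture_hall weak (Suc m) j)
      = (\<Sum>i\<in>{0..j}. card (lecture_hall weak m (i * int m div int (Suc m))))"
    by (simp add: card_image[OF inj])
qed

lemma lecture_hall_0: "lecture_hall weak 0 j = (if 0 \<le> j then {\<lambda>_. 0} else {})"
proof -
  have "b 0 = 0 \<and> (\<forall>k>0. b k = 0) \<longleftrightarrow> b = (\<lambda>_. 0)" for b :: "nat \<Rightarrow> int"
    unfolding fun_eq_iff by (metis gr0I)
  then have "b \<in> lecture_hall weak 0 j \<longleftrightarrow> b = (\<lambda>_. 0) \<and> 0 \<le> j" for b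
    unfolding lecture_hall_weak by (metis atLeastLessThan_iff less_nat_zero_code order_refl zero_less_one)
  then show ?thesis by auto
qed

lemma finite_lecture_hall: "finite (lecture_hall weak m j)"
proof (induction m arbitrary: j)
  case (Suc m)
  then show ?case by (rule card_lecture_hall_Suc(1))
qed (simp add: lecture_hall_0)

text \<open>Going from bound \<open>(m + 1) t + r\<close> to the next one adds the sequences whose last term is
  \<open>(m + 1) t + r + 1\<close>, and for these the bound on the previous term is \<open>m t + r\<close>. The induction
  hypothesis counts \<open>(t + 1)\<^sup>m\<^sup>-\<^sup>r (t + 2)\<^sup>r\<close> of them, which is the difference of consecutive values
  of the product formula. The value at \<open>r = m + 1\<close> for \<open>t\<close> agrees with that at \<open>r = 0\<close> for
  \<open>t + 1\<close>, so the blocks fit together.\<close>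

lemma card_lecture_hall:
  "r \<le> m \<Longrightarrow> card (lecture_hall weak m (int (m * t + r))) = (t + 1) ^ (m - r) * (t + 2) ^ r"
proof (induction m arbitrary: t r)
  case 0
  then show ?case by (simp add: lecture_hall_0)
next
  case (Suc m)
  note outer = Suc.IH
  let ?Q = "\<lambda>j. card (lecture_hall weak (Suc m) (int j))"
  have step: "?Q (Suc j) = ?Q j + card (lecture_hall weak m (int (Suc j * m div Suc m)))" for j
  proof -
    have "{0..int (Suc j)} = insert (int (Suc j)) {0..int j}" by auto
    moreover have "int (Suc j) * int m div int (Suc m) = int (Suc j * m div Suc m)"
      by (simp only: of_nat_mult zdiv_int)
    ultimately show ?thesis
      by (simp add: card_lecture_hall_Suc(2)[OF finite_lecture_hall] del: of_nat_Suc)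
  qed
  have block: "?Q (Suc m * t + r) + (t + 1) ^ Suc m
      = ?Q (Suc m * t) + (t + 1) ^ (Suc m - r) * (t + 2) ^ r"
    if "r \<le> Suc m" for r t
    using that
  proof (induction r)
    case (Suc r)
    have "Suc (Suc m * t + r) * m = (m * t + r) * Suc m + (m - r)"
      using Suc.prems by (simp add: algebra_simps)
    moreover have "(m - r) div Suc m = 0" by simp
    ultimately have "Suc (Suc m * t + r) * m div Suc m = m * t + r"
      by (metis add_0 add.commute div_mult_self3 nat.simps(3))
    then have Q: "?Q (Suc m * t + Suc r) = ?Q (Suc m * t + r) + (t + 1) ^ (m - r) * (t + 2) ^ r"
      using step[of "Suc m * t + r"] Suc.IH Suc.prems outer[of r t] by simp
    have "(t + 1) ^ (Suc m - Suc r) * (t + 2) ^ Suc r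
        = (t + 1) ^ (m - r) * (t + 2) ^ r * ((t + 1) + 1)"
      by (simp add: algebra_simps)
    also have "\<dots> = (t + 1) ^ (Suc m - r) * (t + 2) ^ r + (t + 1) ^ (m - r) * (t + 2) ^ r"
      using Suc.prems by (simp add: Suc_diff_le algebra_simps)
    finally show ?case using Q Suc.IH Suc.prems by linarith
  qed simp
  have full: "?Q (Suc m * t) = (t + 1) ^ Suc m" for t
  proof (induction t)
    case 0
    show ?case
      using card_lecture_hall_Suc(2)[OF finite_lecture_hall, of m 0] Suc.IH[of 0 0] by simp
  next
    case (Suc t)
    then show ?case using block[of "Suc m" t] by (simp add: algebra_simps)
  qed
  show ?case using block[OF Suc.prems, of t] full[of t] by simp
qed

text \<open>The sequence \<open>w\<^sub>k = 2k - 1\<close> satisfies every inequality with the least possible integer gap: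
  \<open>w\<^sub>1 = 1\<close>, \<open>k w\<^sub>k\<^sub>+\<^sub>1 - (k + 1) w\<^sub>k = 1\<close> and \<open>2m - w\<^sub>m = 1\<close>. As \<open>a < c\<close> means \<open>a + 1 \<le> c\<close> for
  integers, translation by \<open>w\<close> exchanges weak and strict chains. It corresponds to the only
  interior lattice point of the doubled simplex.\<close>

lemma bij_betw_lecture_hall_strict:
  assumes "m \<ge> 1"
  shows "bij_betw (\<lambda>b k. if k \<in> {1..m} then b k + (2 * int k - 1) else 0)
    (lecture_hall weak m j) (lecture_hall strict m (j + 2 * int m))"
proof (rule bij_betw_byWitness[where f' = "\<lambda>b k. if k \<in> {1..m} then b k - (2 * int k - 1) else 0"])
  have gap: "int k * (2 * int (k + 1) - 1) - int (k + 1) * (2 * int k - 1) = 1" for k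
    by (simp add: algebra_simps)
  show "(\<lambda>b k. if k \<in> {1..m} then b k + (2 * int k - 1) else 0) ` lecture_hall weak m j
      \<subseteq> lecture_hall strict m (j + 2 * int m)"
  proof (clarsimp simp only: lecture_hall_weak lecture_hall_strict image_subset_iff, intro conjI ballI)
    fix b k assume b: "\<forall>k\<in>{1..<m}. int (k + 1) * b k \<le> int k * b (k + 1)" and k: "k \<in> {1..<m}"
    have "int (k + 1) * b k \<le> int k * b (k + 1)" using b k by blast
    then have "int (k + 1) * (b k + (2 * int k - 1)) < int k * (b (k + 1) + (2 * int (k + 1) - 1))"
      using gap[of k] by (simp only: distrib_left)
    then show "int (k + 1) * (if k \<in> {1..m} then b k + (2 * int k - 1) else 0)
        < int k * (if k + 1 \<in> {1..m} then b (k + 1) + (2 * int (k + 1) - 1) else 0)"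
      using k by simp
  qed (use assms in auto)
  show "(\<lambda>b k. if k \<in> {1..m} then b k - (2 * int k - 1) else 0) ` lecture_hall strict m (j + 2 * int m)
      \<subseteq> lecture_hall weak m j"
  proof (clarsimp simp only: lecture_hall_weak lecture_hall_strict image_subset_iff, intro conjI ballI)
    fix b k assume b: "\<forall>k\<in>{1..<m}. int (k + 1) * b k < int k * b (k + 1)" and k: "k \<in> {1..<m}"
    have "int (k + 1) * b k < int k * b (k + 1)" using b k by blast
    then have "int (k + 1) * (b k - (2 * int k - 1)) \<le> int k * (b (k + 1) - (2 * int (k + 1) - 1))"
      using gap[of k] by (simp only: right_diff_distrib)
    then show "int (k + 1) * (if k \<in> {1..m} then b k - (2 * int k - 1) else 0)
        \<le> int k * (if k + 1 \<in> {1..m} then b (k + 1) - (2 * int (k + 1) - 1) else 0)"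
      using k by simp
  qed (use assms in auto)
qed (auto simp: lecture_hall_weak lecture_hall_strict fun_eq_iff not_le Suc_le_eq)

lemma card_lecture_hall_strict:
  assumes "m \<ge> 1"
  shows "card (lecture_hall strict m (int m * int (t + 2))) = (t + 1) ^ m"
    and "card (lecture_hall strict m (int m)) = 0"
proof -
  show "card (lecture_hall strict m (int m * int (t + 2))) = (t + 1) ^ m"
    using bij_betw_same_card[OF bij_betw_lecture_hall_strict[OF assms, of "int (m * t + 0)"]]
      card_lecture_hall[of 0 m t] by (simp add: algebra_simps)
  have "b m \<ge> 0 \<and> b m \<le> - int m" if "b \<in> lecture_hall weak m (- int m)" for b
    using lecture_hall_weak_nonneg[OF that, of m] that by (simp add: lecture_hall_weak)
  then have "lecture_hall weak m (- int m) = {}"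
    using assms by force
  then show "card (lecture_hall strict m (int m)) = 0"
    using bij_betw_same_card[OF bij_betw_lecture_hall_strict[OF assms, of "- int m"]]
    by simp
qed

section \<open>The simplex and its lattice points\<close>

definition pos :: "'n::{finite,linorder} \<Rightarrow> nat" where
  "pos i = card {j. j < i}"

lemma bij_betw_pos: "bij_betw (pos :: 'n::{finite,linorder} \<Rightarrow> nat) UNIV {..<CARD('n)}"
proof -
  have mono: "pos i < pos j" if "i < j" for i j :: 'n
    unfolding pos_def using that by (intro psubset_card_mono) auto
  have inj: "inj (pos :: 'n \<Rightarrow> nat)"
    by (rule injI) (metis mono less_irrefl linorder_less_linear)
  have "pos i < CARD('n)" for i :: 'n
    unfolding pos_def by (intro psubset_card_mono) auto
  then have "range (pos :: 'n \<Rightarrow> nat) = {..<CARD('n)}"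
    using inj by (intro card_subset_eq) (auto simp: card_image)
  then show ?thesis using inj by (simp add: bij_betw_def)
qed

abbreviation vert :: "nat \<Rightarrow> real ^ 'n::{finite,linorder}" where
  "vert k \<equiv> perm_point (one_at CARD('n) k)"

lemma pos_less: "pos (i :: 'n::{finite,linorder}) < CARD('n::{finite,linorder})"
  using bij_betw_pos[where 'n = 'n] by (auto simp: bij_betw_def)

lemma obtain_pos:
  assumes "k < CARD('n::{finite,linorder})"
  obtains i :: "'n::{finite,linorder}" where "pos i = k"
proof -
  have "k \<in> range (pos :: 'n \<Rightarrow> nat)"
    using assms bij_betw_pos[where 'n = 'n] by (simp add: bij_betw_def)
  then show thesis using that by blast
qed

text \<open>For \<open>j = pos i\<close>, the \<open>j\<close>-th entry of the \<open>k\<close>-th vertex is \<open>j + 2\<close>, diminished by \<open>1\<close> if \<open>k < j\<close>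
  and by \<open>j + 1\<close> if \<open>k = j\<close>. Writing both corrections through the partial sums \<open>M\<^sub>k\<close> of \<open>\<mu>\<close> gives
  the difference \<open>j M\<^sub>j - (j + 1) M\<^sub>j\<^sub>+\<^sub>1\<close>, so the weights can be recovered from the
  coordinates one after the other.\<close>

lemma combination_nth:
  fixes i :: "'n::{finite,linorder}"
  shows "(\<Sum>k<CARD('n). \<mu> k *\<^sub>R (vert k :: (real, 'n) vec)) $ i
    = (\<Sum>k<CARD('n). \<mu> k) * real (pos i + 2) + real (pos i) * (\<Sum>k<pos i. \<mu> k)
      - real (pos i + 1) * (\<Sum>k<pos i + 1. \<mu> k)"
proof -
  let ?n = "CARD('n)" and ?j = "pos i"
  note j = pos_less[of i]
  have v: "(vert k :: (real, 'n) vec) $ i = real (?j + 2) - (if k < ?j then 1 else 0)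
      - (if k = ?j then real (?j + 1) else 0)" if "k < ?n" for k
    using nth_one_at[OF j that] by (auto simp: perm_point_def pos_def[symmetric])
  have "(\<Sum>k<?n. \<mu> k *\<^sub>R (vert k :: (real, 'n) vec)) $ i
      = (\<Sum>k<?n. \<mu> k * real (?j + 2) - (if k < ?j then \<mu> k else 0)
          - (if k = ?j then \<mu> k * real (?j + 1) else 0))"
    by (auto simp: v right_diff_distrib intro!: sum.cong)
  also have "\<dots> = (\<Sum>k<?n. \<mu> k) * real (?j + 2) - (\<Sum>k<?n. if k < ?j then \<mu> k else 0)
      - \<mu> ?j * real (?j + 1)"
    using j by (simp add: sum_subtractf sum_distrib_right)
  also have "(\<Sum>k<?n. if k < ?j then \<mu> k else 0) = (\<Sum>k<?j. \<mu> k)"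
    using j by (intro sum.mono_neutral_cong_right) auto
  finally show ?thesis by (simp add: algebra_simps)
qed

text \<open>Affine independence of the vertices: the formula above makes \<open>k M\<^sub>k\<close> independent of \<open>k\<close>, hence
  equal to its value \<open>0\<close> at \<open>k = 0\<close>.\<close>

lemma combination_inj:
  fixes \<mu> :: "nat \<Rightarrow> real"
  assumes "(\<Sum>k<CARD('n::{finite,linorder}). \<mu> k) = 0"
    and "(\<Sum>k<CARD('n). \<mu> k *\<^sub>R (vert k :: real ^ 'n::{finite,linorder})) = 0" and "k < CARD('n)"
  shows "\<mu> k = 0"
proof -
  define M where "M k = real k * (\<Sum>l<k. \<mu> l)" for k
  have M0: "M k = 0" if "k \<le> CARD('n)" for k
    using that
  proof (induction k)
    case (Suc k)
    then obtain i :: 'n where i: "pos i = k"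
      using obtain_pos[where 'n = 'n and k = k] by (metis Suc_le_eq)
    have "M k - M (k + 1) = 0"
      using combination_nth[of \<mu> i] i assms by (simp add: M_def)
    then show ?case using Suc by simp
  qed (simp add: M_def)
  have S: "(\<Sum>l<k. \<mu> l) = 0" if "k \<le> CARD('n)" for k
    using M0[OF that] unfolding M_def by (cases "k = 0") auto
  show ?thesis using S[of k] S[of "Suc k"] assms(3) by simp
qed

lemma inj_on_vert: "inj_on (vert :: nat \<Rightarrow> real ^ 'n::{finite,linorder}) {..<CARD('n)}"
proof (rule linorder_inj_onI)
  fix a b assume ab: "a < b" "a \<in> {..<CARD('n)}" "b \<in> {..<CARD('n)}"
  obtain i :: 'n where i: "pos i = a"
    using obtain_pos[where 'n = 'n and k = a] ab by auto
  show "(vert a :: (real, 'n) vec) \<noteq> vert b"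
    using ab i nth_one_at[of a "CARD('n)" a] nth_one_at[of a "CARD('n)" b]
    by (auto simp: vec_eq_iff perm_point_def pos_def[symmetric] intro!: exI[of _ i])
qed auto

abbreviation dilated :: "(real \<Rightarrow> bool) \<Rightarrow> real \<Rightarrow> (real ^ 'n::{finite,linorder}) set" where
  "dilated P t \<equiv> {\<Sum>k<CARD('n). \<mu> k *\<^sub>R vert k | \<mu>.
     (\<forall>k<CARD('n). P (\<mu> k)) \<and> (\<Sum>k<CARD('n). \<mu> k) = t}"

text \<open>The library describes convex hulls and their relative interiors by weights on the set of
  vertices. Here the weights are indexed by the position of the entry \<open>1\<close>, whose order
  matters for the partial sums.\<close>

lemma barycentric_reindex:
  "{y. \<exists>u. (\<forall>x\<in>vert ` {..<CARD('n)}. P (u x)) \<and> sum u (vert ` {..<CARD('n)}) = 1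
      \<and> (\<Sum>x\<in>vert ` {..<CARD('n)}. u x *\<^sub>R x) = y} = (dilated P 1 :: (real ^ 'n::{finite,linorder}) set)"
  (is "?L = ?R")
proof (intro equalityI subsetI)
  fix y assume "y \<in> ?L"
  then obtain u where "\<forall>x\<in>vert ` {..<CARD('n)}. P (u x)" "sum u (vert ` {..<CARD('n)}) = 1"
    "(\<Sum>x\<in>vert ` {..<CARD('n)}. u x *\<^sub>R x) = y" by blast
  then show "y \<in> ?R"
    by (auto simp: sum.reindex[OF inj_on_vert] intro!: exI[of _ "u \<circ> vert"])
next
  fix y :: "(real, 'n) vec" assume "y \<in> ?R"
  then obtain \<mu> where \<mu>: "\<forall>k<CARD('n). P (\<mu> k)" "(\<Sum>k<CARD('n). \<mu> k) = 1"
    "y = (\<Sum>k<CARD('n). \<mu> k *\<^sub>R vert k)" by blast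
  let ?u = "\<mu> \<circ> the_inv_into {..<CARD('n)} (vert :: nat \<Rightarrow> (real, 'n) vec)"
  have "?u (vert k) = \<mu> k" if "k < CARD('n)" for k
    using that by (simp add: the_inv_into_f_f[OF inj_on_vert])
  then show "y \<in> ?L"
    using \<mu> by (auto simp: sum.reindex[OF inj_on_vert] intro!: exI[of _ ?u])
qed

lemma stack_simplex_eq:
  "stack_simplex CARD('n) = convex hull (vert ` {..<CARD('n)} :: (real ^ 'n::{finite,linorder}) set)"
  unfolding stack_simplex_def by (simp add: stack_iterates_tau image_image Suc_le_eq)

lemma stack_simplex_barycentric:
  "stack_simplex CARD('n) = (dilated weak 1 :: (real ^ 'n::{finite,linorder}) set)"
  unfolding stack_simplex_eq using barycentric_reindex[of weak, where 'n = 'n]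
  by (simp add: convex_hull_finite)

lemma rel_interior_stack_simplex:
  "rel_interior (stack_simplex CARD('n)) = (dilated strict 1 :: (real ^ 'n::{finite,linorder}) set)"
proof -
  let ?V = "vert ` {..<CARD('n)} :: ((real, 'n) vec) set"
  have "\<not> affine_dependent ?V"
  proof
    assume "affine_dependent ?V"
    then obtain u where u: "sum u ?V = 0" "\<exists>v\<in>?V. u v \<noteq> 0" "(\<Sum>v\<in>?V. u v *\<^sub>R v) = 0"
      by (auto simp: affine_dependent_explicit_finite)
    then show False
      using combination_inj[of "u \<circ> vert", where 'n = 'n]
      by (auto simp: sum.reindex[OF inj_on_vert])
  qed
  then show ?thesis
    unfolding stack_simplex_eq using barycentric_reindex[of strict, where 'n = 'n]
    by (simp add: rel_interior_convex_hull_explicit)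
qed

lemma scale_dilated:
  assumes P: "\<And>c u. c > 0 \<Longrightarrow> P (c * u) = P u" and "t > 0"
  shows "(\<lambda>x. t *\<^sub>R x) ` dilated P 1 = (dilated P t :: (real ^ 'n::{finite,linorder}) set)"
proof (intro equalityI subsetI)
  fix y :: "(real, 'n) vec" assume "y \<in> (\<lambda>x. t *\<^sub>R x) ` dilated P 1"
  then obtain \<mu> where "\<forall>k<CARD('n). P (\<mu> k)" "(\<Sum>k<CARD('n). \<mu> k) = 1"
    "y = t *\<^sub>R (\<Sum>k<CARD('n). \<mu> k *\<^sub>R vert k)" by blast
  then show "y \<in> dilated P t"
    using assms by (auto simp: scaleR_sum_right sum_distrib_left[symmetric]
        intro!: exI[of _ "\<lambda>k. t * \<mu> k"])
next
  fix y :: "(real, 'n) vec" assume "y \<in> dilated P t"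
  then obtain \<mu> where \<mu>: "\<forall>k<CARD('n). P (\<mu> k)" "(\<Sum>k<CARD('n). \<mu> k) = t"
    "y = (\<Sum>k<CARD('n). \<mu> k *\<^sub>R vert k)" by blast
  have "y = t *\<^sub>R (\<Sum>k<CARD('n). (inverse t * \<mu> k) *\<^sub>R vert k)"
    unfolding \<mu>(3) scaleR_sum_right using \<open>t > 0\<close> by (simp add: mult.assoc[symmetric])
  moreover have "\<forall>k<CARD('n). P (inverse t * \<mu> k)" "(\<Sum>k<CARD('n). inverse t * \<mu> k) = 1"
    using \<mu> assms by (simp_all add: sum_distrib_left[symmetric])
  ultimately show "y \<in> (\<lambda>x. t *\<^sub>R x) ` dilated P 1"
    by (intro image_eqI[where x = "\<Sum>k<CARD('n). (inverse t * \<mu> k) *\<^sub>R vert k"] CollectI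
        exI[of _ "\<lambda>k. inverse t * \<mu> k"] conjI) simp_all
qed

text \<open>The last partial sum is \<open>t\<close> for every point of the dilated simplex, so the term with index
  \<open>n\<close> is forced to be \<open>t n\<close>. Lecture hall sequences of length \<open>n - 1\<close> leave it out, and it is put
  back here.\<close>

definition lecture_hall_point :: "int \<Rightarrow> (nat \<Rightarrow> int) \<Rightarrow> real ^ 'n::{finite,linorder}" where
  "lecture_hall_point t b = (let c = b(CARD('n) := t * int CARD('n)) in
     \<chi> i. of_int (t * int (pos i + 2) + c (pos i) - c (pos i + 1)))"

text \<open>The weights that belong to \<open>c\<close>, the completed sequence, are \<open>\<mu>\<^sub>k = c\<^sub>k\<^sub>+\<^sub>1/(k + 1) - c\<^sub>k/k\<close>, a
  positive multiple of \<open>k c\<^sub>k\<^sub>+\<^sub>1 - (k + 1) c\<^sub>k\<close> for \<open>k \<ge> 1\<close>. The assumption on \<open>P\<close> says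
  that the sign condition does not see such positive factors.\<close>

lemma bij_betw_lecture_hall_point:
  assumes P: "\<And>c u. c > 0 \<Longrightarrow> P (c * u) = P u" and n: "CARD('n::{finite,linorder}) \<ge> 2"
  shows "bij_betw (lecture_hall_point t :: _ \<Rightarrow> real ^ 'n::{finite,linorder})
    (lecture_hall P (CARD('n) - 1) (int (CARD('n) - 1) * t)) (dilated P (of_int t) \<inter> int_lattice)"
proof (rule bij_betw_imageI)
  let ?n = "CARD('n)"
  let ?LH = "lecture_hall P (?n - 1) (int (?n - 1) * t)"
  show "inj_on (lecture_hall_point t :: _ \<Rightarrow> (real, 'n) vec) ?LH"
  proof (rule inj_onI)
    fix b b' assume b: "b \<in> ?LH" "b' \<in> ?LH"
      and eq: "(lecture_hall_point t b :: (real, 'n) vec) = lecture_hall_point t b'"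
    define c c' where "c = b(?n := t * int ?n)" and "c' = b'(?n := t * int ?n)"
    have "c k = c' k" if "k \<le> ?n" for k
      using that
    proof (induction k)
      case 0
      show ?case using b n by (simp add: c_def c'_def lecture_hall_def)
    next
      case (Suc k)
      then obtain i :: 'n where i: "pos i = k"
        using obtain_pos[where 'n = 'n and k = k] by (metis Suc_le_eq)
      have "(lecture_hall_point t b :: (real, 'n) vec) $ i = lecture_hall_point t b' $ i"
        by (simp only: eq)
      then have "c k - c (k + 1) = c' k - c' (k + 1)"
        unfolding lecture_hall_point_def Let_def c_def[symmetric] c'_def[symmetric]
        by (simp add: i)
      then show ?case using Suc by simp
    qed
    then have "b k = b' k" if "k < ?n" for k
      using that unfolding c_def c'_def by (metis fun_upd_apply less_imp_le less_irrefl)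
    moreover have "b k = b' k" if "k \<ge> ?n" for k
      using b that n by (auto simp: lecture_hall_def)
    ultimately show "b = b'" by (metis ext linorder_not_less)
  qed
  show "lecture_hall_point t ` ?LH = (dilated P (of_int t) \<inter> int_lattice :: ((real, 'n) vec) set)"
  proof (intro equalityI subsetI)
    fix x :: "(real, 'n) vec" assume "x \<in> lecture_hall_point t ` ?LH"
    then obtain b where b: "b \<in> ?LH" and x: "x = lecture_hall_point t b" by blast
    define c where "c = b(?n := t * int ?n)"
    \<comment> \<open>For \<open>k = 0\<close> the subtrahend is \<open>0 / 0 = 0\<close>, so the sums below telescope from the start.\<close>
    define \<mu> where "\<mu> k = of_int (c (k + 1)) / real (k + 1) - of_int (c k) / real k" for k
    have c0: "c 0 = 0" using b n by (simp add: c_def lecture_hall_def)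
    have M: "(\<Sum>l<k. \<mu> l) = of_int (c k) / real k" for k
      by (induction k) (simp_all add: \<mu>_def c0)
    have sum: "(\<Sum>l<?n. \<mu> l) = of_int t"
      unfolding M by (simp add: c_def)
    have kM: "real k * (\<Sum>l<k. \<mu> l) = of_int (c k)" for k
      unfolding M by (cases "k = 0") (simp_all add: c0)
    have "x = (\<Sum>k<?n. \<mu> k *\<^sub>R vert k)"
      unfolding x lecture_hall_point_def Let_def c_def[symmetric] vec_eq_iff combination_nth
        kM sum by simp
    moreover have "P (\<mu> k)" if "k < ?n" for k
    proof (cases "k = 0")
      case True
      then show ?thesis using b n by (simp add: \<mu>_def c_def lecture_hall_def)
    next
      case False
      have \<mu>: "\<mu> k = (1 / (real k * real (k + 1)))
          * of_int (int k * c (k + 1) - int (k + 1) * c k)"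
        using False by (simp add: \<mu>_def field_simps)
      have "P (of_int (int k * c (k + 1) - int (k + 1) * c k))"
        \<comment> \<open>The last inequality of the chain carries an extra factor \<open>n\<close> because the final term is
          \<open>t n\<close>.\<close>
      proof (cases "k = ?n - 1")
        case True
        then have "int k * c (k + 1) - int (k + 1) * c k = int ?n * (int (?n - 1) * t - b (?n - 1))"
          using n by (simp add: c_def algebra_simps)
        then show ?thesis
          using b P[of "real ?n" "of_int (int (?n - 1) * t - b (?n - 1))"]
          by (simp add: lecture_hall_def)
      next
        case False
        then show ?thesis using b that \<open>k \<noteq> 0\<close> by (auto simp: c_def lecture_hall_def)
      qed
      then show ?thesis unfolding \<mu> using False by (subst P) auto
    qed
    moreover have "x \<in> int_lattice"
      unfolding x lecture_hall_point_def Let_def int_lattice_def by simp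
    ultimately show "x \<in> dilated P (of_int t) \<inter> int_lattice"
      using sum by blast
  next
    fix x :: "(real, 'n) vec" assume "x \<in> dilated P (of_int t) \<inter> int_lattice"
    then obtain \<mu> where \<mu>: "\<And>k. k < ?n \<Longrightarrow> P (\<mu> k)" "(\<Sum>k<?n. \<mu> k) = of_int t"
      and x: "x = (\<Sum>k<?n. \<mu> k *\<^sub>R vert k)" and int: "\<And>i. x $ i \<in> \<int>"
      unfolding int_lattice_def by blast
    define M where "M k = real k * (\<Sum>l<k. \<mu> l)" for k
    have xi: "x $ i = of_int t * real (pos i + 2) + M (pos i) - M (pos i + 1)" for i
      unfolding x combination_nth \<mu>(2) M_def by simp
    \<comment> \<open>Consecutive values of \<open>M\<close> differ by an integer since the coordinates of \<open>x\<close> are integers.\<close>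
    have M_int: "M k \<in> \<int>" if "k \<le> ?n" for k
      using that
    proof (induction k)
      case (Suc k)
      then obtain i :: 'n where i: "pos i = k"
        using obtain_pos[where 'n = 'n and k = k] by (metis Suc_le_eq)
      have "M (Suc k) = of_int t * real (k + 2) + M k - x $ i"
        unfolding xi i by simp
      also have "\<dots> \<in> \<int>"
        using Suc int by (intro Ints_diff Ints_add Ints_mult) auto
      finally show ?case .
    qed (simp add: M_def)
    define c where "c k = \<lfloor>M k\<rfloor>" for k
    have cM: "of_int (c k) = M k" if "k \<le> ?n" for k
      unfolding c_def using M_int[OF that] by (metis Ints_cases floor_of_int)
    define b where "b k = (if k < ?n then c k else 0)" for k
    have "M ?n = of_int (t * int ?n)" unfolding M_def \<mu>(2) by simp
    then have "c ?n = t * int ?n" by (simp only: c_def floor_of_int)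
    then have bc: "(b(?n := t * int ?n)) k = c k" if "k \<le> ?n" for k
      using that by (auto simp: b_def)
    have "x = lecture_hall_point t b"
      unfolding lecture_hall_point_def Let_def vec_eq_iff
    proof (intro allI)
      fix i :: 'n
      have "pos i \<le> ?n" "pos i + 1 \<le> ?n" using pos_less[of i] by auto
      then show "x $ i = (\<chi> i. of_int (t * int (pos i + 2) + (b(?n := t * int ?n)) (pos i)
          - (b(?n := t * int ?n)) (pos i + 1))) $ i"
        by (simp add: bc xi cM del: fun_upd_apply)
    qed
    moreover have "b \<in> ?LH"
    proof -
      have diff: "real k * M (k + 1) - real (k + 1) * M k = real k * real (k + 1) * \<mu> k" for k
        by (simp add: M_def algebra_simps)
      have "P (of_int (int k * b (k + 1) - int (k + 1) * b k))" if k: "k \<in> {1..<?n - 1}" for k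
      proof -
        have kn: "k < ?n" "k + 1 < ?n" using k by auto
        have "of_int (int k * b (k + 1) - int (k + 1) * b k) = real k * M (k + 1) - real (k + 1) * M k"
          using kn by (simp add: b_def cM)
        then show ?thesis using P[of "real k * real (k + 1)"] \<mu>(1)[of k] k kn diff[of k] by simp
      qed
      moreover have "P (of_int (int (?n - 1) * t - b (?n - 1)))"
      proof -
        have "M ?n = real ?n * of_int t" unfolding M_def \<mu>(2) ..
        then have "real ?n * of_int (int (?n - 1) * t - b (?n - 1))
            = real (?n - 1) * M (?n - 1 + 1) - real (?n - 1 + 1) * M (?n - 1)"
          using n by (simp add: b_def cM right_diff_distrib)
        then have "real ?n * of_int (int (?n - 1) * t - b (?n - 1))
            = real (?n - 1) * real ?n * \<mu> (?n - 1)"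
          unfolding diff using n by simp
        then show ?thesis
          using P[of "real ?n" "of_int (int (?n - 1) * t - b (?n - 1))"]
            P[of "real (?n - 1)" "\<mu> (?n - 1)"] \<mu>(1)[of "?n - 1"] n by simp
      qed
      moreover have "P (of_int (b 1))"
        using n cM[of 1] \<mu>(1)[of 0] by (simp add: b_def M_def)
      ultimately show ?thesis
        by (auto simp: lecture_hall_def b_def c_def M_def)
    qed
    ultimately show "x \<in> lecture_hall_point t ` ?LH" by blast
  qed
qed

lemma card_dilated:
  assumes "\<And>c u. c > 0 \<Longrightarrow> P (c * u) = P u" "CARD('n::{finite,linorder}) \<ge> 2"
  shows "card (dilated P (real t) \<inter> int_lattice :: (real ^ 'n::{finite,linorder}) set)
    = card (lecture_hall P (CARD('n) - 1) (int (CARD('n) - 1) * int t))"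
  using bij_betw_same_card[OF bij_betw_lecture_hall_point[where P = P and t = "int t" and 'n = 'n]]
    assms by simp

lemma lattice_count_stack_simplex:
  assumes "CARD('n::{finite,linorder}) \<ge> 2"
  shows "lattice_count (stack_simplex CARD('n) :: (real ^ 'n::{finite,linorder}) set) t
    = (t + 1) ^ (CARD('n) - 1)"
proof -
  have "(\<lambda>x. real t *\<^sub>R x) ` stack_simplex CARD('n) = (dilated weak (real t) :: ((real, 'n) vec) set)"
  \<comment> \<open>Scaling by \<open>0\<close> is not invertible. Both sides are then the origin: on the right because
    nonnegative weights with sum \<open>0\<close> vanish.\<close>
  proof (cases "t = 0")
    case True
    have "stack_simplex CARD('n) \<noteq> ({} :: ((real, 'n) vec) set)"
      unfolding stack_simplex_eq by (simp add: lessThan_empty_iff)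
    then have "(\<lambda>x. real t *\<^sub>R x) ` stack_simplex CARD('n) = {0 :: (real, 'n) vec}"
      using True by auto
    moreover have "dilated weak (real t) = {0 :: (real, 'n) vec}"
    proof -
      have "(\<Sum>k<CARD('n). \<mu> k *\<^sub>R vert k) = (0 :: (real, 'n) vec)"
        if "\<forall>k<CARD('n). 0 \<le> \<mu> k" "(\<Sum>k<CARD('n). \<mu> k) = 0" for \<mu> :: "nat \<Rightarrow> real"
        using that by (subst (asm) sum_nonneg_eq_0_iff) auto
      then show ?thesis using True by (auto intro!: exI[of _ "\<lambda>_. 0"])
    qed
    ultimately show ?thesis by simp
  next
    case False
    then show ?thesis
      unfolding stack_simplex_barycentric by (intro scale_dilated) (auto simp: zero_le_mult_iff)
  qed
  then show ?thesis
    using card_dilated[where P = weak and t = t and 'n = 'n] assms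
      card_lecture_hall[of 0 "CARD('n) - 1" t]
    by (simp add: lattice_count_def zero_le_mult_iff)
qed

lemma lattice_count_rel_interior:
  assumes "CARD('n::{finite,linorder}) \<ge> 2" "t > 0"
  shows "lattice_count (rel_interior (stack_simplex CARD('n)) :: (real ^ 'n::{finite,linorder}) set) t
    = card (lecture_hall strict (CARD('n) - 1) (int (CARD('n) - 1) * int t))"
proof -
  have "(\<lambda>x. real t *\<^sub>R x) ` rel_interior (stack_simplex CARD('n))
      = (dilated strict (real t) :: ((real, 'n) vec) set)"
    unfolding rel_interior_stack_simplex
    using assms(2) by (intro scale_dilated) (auto simp: zero_less_mult_iff)
  then show ?thesis
    using card_dilated[where P = strict and t = t and 'n = 'n] assms
    by (simp add: lattice_count_def zero_less_mult_iff)
qed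

lemma lattice_polytope_stack_simplex:
  "lattice_polytope (stack_simplex CARD('n) :: (real ^ 'n::{finite,linorder}) set)"
  unfolding lattice_polytope_def stack_simplex_eq
  by (intro exI[of _ "vert ` {..<CARD('n)}"]) (auto simp: int_lattice_def perm_point_def)

theorem mainTheorem5:
  fixes n :: nat and T :: "(real ^ 'n::{finite,linorder}) set"
  assumes "CARD('n) = n" and "n \<ge> 2"
    and "T = stack_simplex n"
  shows "(\<forall>t::nat. lattice_count (rel_interior T) (t + 2) = (t + 1) ^ (n - 1)
                   \<and> (t + 1) ^ (n - 1) = lattice_count T t)
    \<and> lattice_count (rel_interior T) 1 = 0
    \<and> lattice_count (rel_interior T) 2 = 1
    \<and> gorenstein T 2"
proof -
  have n: "CARD('n) \<ge> 2" and T: "T = stack_simplex CARD('n)" and m: "n - 1 \<ge> 1"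
    using assms by auto
  have closed: "lattice_count T t = (t + 1) ^ (n - 1)" for t
    unfolding T using lattice_count_stack_simplex[OF n] assms(1) by simp
  have interior: "lattice_count (rel_interior T) (t + 2) = (t + 1) ^ (n - 1)" for t
    unfolding T using lattice_count_rel_interior[OF n, of "t + 2"]
      card_lecture_hall_strict(1)[OF m, of t] assms(1) by simp
  have one: "lattice_count (rel_interior T) 1 = 0"
    unfolding T using lattice_count_rel_interior[OF n, of 1]
      card_lecture_hall_strict(2)[OF m] assms(1) by simp
  have two: "lattice_count (rel_interior T) 2 = 1"
    using interior[of 0] by (simp add: numeral_2_eq_2)
  have "lattice_count (rel_interior T) t = lattice_count T (t - 2)" if "t > 2" for t
    using interior[of "t - 2"] closed[of "t - 2"] le_add_diff_inverse2[of 2 t] that by simp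
  then have "gorenstein T 2"
    unfolding gorenstein_def using one two lattice_polytope_stack_simplex T by auto
  then show ?thesis using interior closed one two by auto
qed

end
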